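(* $\mathrm{QEC}(\mathbb Z_+)=\mathrm{QEC}(\mathbb Z)=-\dfrac12$.
   Context: Here $\mathbb Z$ denotes the one-dimensional integer lattice, i.e. the two-sided infinite path graph with vertex set the integers and edges $\{k,k+1\}$, $k\in\mathbb Z$; $\mathbb Z_+$ denotes the one-sided infinite path graph on $\{0,1,2,\dots\}$ with edges $\{k,k+1\}$, $k\ge0$. For a connected graph $G=(V,E)$, $d(x,y)$ denotes the graph distance and $D=[d(x,y)]_{x,y\in V}$ the distance matrix. $C_0(V)$ is the space of real-valued functions on $V$ with finite support, $\langle f,g\rangle=\sum_{x\in V}f(x)g(x)$, $\langle \mathbf 1,f\rangle=\sum_{x\in V}f(x)$. The QE constant is $\mathrm{QEC}(G)=\sup\{\langle f,Df\rangle : f\in C_0(V),\ \langle f,f\rangle=1,\ \langle\mathbf 1,f\rangle=0\}$. *)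

theory Defs
  imports
    "HOL-Analysis.Analysis"
    "Graph_Theory.Pair_Digraph"
    "Graph_Theory.Shortest_Path"
begin

text \<open>
  An undirected graph is a symmetric loop-free \<open>pair_pre_digraph\<close>: every edge \<open>{u, v}\<close> is present
  as the two arcs \<open>(u, v)\<close> and \<open>(v, u)\<close>.
\<close>

definition line_graph_Z :: "int pair_pre_digraph" where
  "line_graph_Z = \<lparr>pverts = UNIV, parcs = {(k, l). l = k + 1 \<or> k = l + 1}\<rparr>"

definition line_graph_Z_plus :: "nat pair_pre_digraph" where
  "line_graph_Z_plus = \<lparr>pverts = UNIV, parcs = {(k, l). l = k + 1 \<or> k = l + 1}\<rparr>"

text \<open>
  Every arc has cost 1, so the cost of a walk is its length. On a connected graph the infimum
  \<open>wf_digraph.\<mu>\<close> is finite; \<open>real_of_ereal\<close> only sends the value for unreachable pairs to 0.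
\<close>

definition graph_dist :: "'a pair_pre_digraph \<Rightarrow> 'a \<Rightarrow> 'a \<Rightarrow> real" where
  "graph_dist G x y = real_of_ereal (wf_digraph.\<mu> (with_proj G) (\<lambda>_. 1) x y)"

text \<open>A function on \<open>V\<close> is represented by its extension by 0 to the whole type.\<close>

definition C0 :: "'a set \<Rightarrow> ('a \<Rightarrow> real) set" where
  "C0 V = {f. finite {x. f x \<noteq> 0} \<and> {x. f x \<noteq> 0} \<subseteq> V}"

definition inner_on :: "'a set \<Rightarrow> ('a \<Rightarrow> real) \<Rightarrow> ('a \<Rightarrow> real) \<Rightarrow> real" where
  "inner_on V f g = (\<Sum>\<^sub>\<infinity>x\<in>V. f x * g x)"

definition dist_matrix_app :: "'a pair_pre_digraph \<Rightarrow> ('a \<Rightarrow> real) \<Rightarrow> 'a \<Rightarrow> real" where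
  "dist_matrix_app G f x = (\<Sum>\<^sub>\<infinity>y\<in>pverts G. graph_dist G x y * f y)"

text \<open>
  For \<open>f \<in> C0 (pverts G)\<close> all the sums involved have finitely many nonzero terms. The supremum is
  taken in \<open>ereal\<close>, since the set of values need not be bounded when \<open>G\<close> is infinite.
\<close>

definition QEC :: "'a pair_pre_digraph \<Rightarrow> ereal" where
  "QEC G = Sup {ereal (inner_on (pverts G) f (dist_matrix_app G f)) | f.
      f \<in> C0 (pverts G) \<and> inner_on (pverts G) f f = 1 \<and> inner_on (pverts G) (\<lambda>_. 1) f = 0}"

lemma bidirected_line_graph_Z: "pair_bidirected_digraph line_graph_Z"
  by unfold_locales (auto simp: line_graph_Z_def symmetric_def sym_def)

lemma bidirected_line_graph_Z_plus: "pair_bidirected_digraph line_graph_Z_plus"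
  by unfold_locales (auto simp: line_graph_Z_plus_def symmetric_def sym_def)

end

theory Submission
  imports Defs "HOL-Real_Asymp.Real_Asymp"
begin

text \<open>
  Both graphs are paths, and the distance of two vertices is the number of cuts between
  consecutive integers \<open>k\<close> and \<open>k + 1\<close> that separate them. Summing over the cuts, a function \<open>f\<close> of
  total sum 0 with partial sums \<open>F k = (\<Sum>j\<le>k. f j)\<close> satisfies
  \<open>\<langle>f, D f\<rangle> = - 2 * (\<Sum>k. (F k)\<^sup>2)\<close>, whereas
  \<open>\<langle>f, f\<rangle> = (\<Sum>k. (F k - F (k - 1))\<^sup>2) \<le> 4 * (\<Sum>k. (F k)\<^sup>2)\<close>.
  Hence \<open>\<langle>f, D f\<rangle> \<le> - \<langle>f, f\<rangle> / 2\<close>.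

  The constant is approached, but not attained, by partial sums that alternate between 1 and -1
  on \<open>0, \<dots>, n - 1\<close> and vanish elsewhere: then \<open>\<langle>f, D f\<rangle> = - 2 * n\<close> and \<open>\<langle>f, f\<rangle> = 4 * n - 2\<close>.
  These functions live on the nonnegative half-line, so one argument serves both graphs.
\<close>

section \<open>Distances in paths of integers\<close>

text \<open>
  The integers and the natural numbers are treated together, as graphs whose vertices are placed
  injectively on an up-closed set of integers containing 0, with arcs between neighbouring
  positions. Up-closedness makes the set of positions an interval, so that the graph is connected,
  and 0 leaves room for the extremal functions.
\<close>

locale integer_path =
  fixes G :: "'a pair_pre_digraph" and pos :: "'a \<Rightarrow> int"
  assumes pverts_eq: "pverts G = UNIV"
    and parcs_eq: "parcs G = {(x, y). \<bar>pos x - pos y\<bar> = 1}"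
    and inj_pos: "inj pos"
    and zero_in_range: "0 \<in> range pos"
    and range_upward: "\<lbrakk>k \<in> range pos; k \<le> l\<rbrakk> \<Longrightarrow> l \<in> range pos"
begin

lemma wf_digraph_with_proj: "wf_digraph (with_proj G)"
  by unfold_locales (auto simp: pverts_eq)

sublocale wf_digraph "with_proj G"
  by (rule wf_digraph_with_proj)

lemma dist_le_awalk_cost:
  assumes "awalk x p y"
  shows "real_of_int \<bar>pos x - pos y\<bar> \<le> awalk_cost (\<lambda>_. 1) p"
  using assms
proof (induction p arbitrary: x)
  case Nil
  then show ?case by (simp add: awalk_Nil_iff)
next
  case (Cons e p)
  then have arc: "\<bar>pos x - pos (snd e)\<bar> = 1" and "awalk (snd e) p y"
    by (auto simp: awalk_Cons_iff parcs_eq)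
  then have "real_of_int \<bar>pos (snd e) - pos y\<bar> \<le> awalk_cost (\<lambda>_. 1) p"
    using Cons.IH by simp
  moreover have "\<bar>pos x - pos y\<bar> \<le> 1 + \<bar>pos (snd e) - pos y\<bar>"
    using arc by linarith
  ultimately show ?case by simp
qed

lemma ex_awalk_of_dist:
  "\<bar>pos x - pos y\<bar> = int n \<Longrightarrow> \<exists>p. awalk x p y \<and> awalk_cost (\<lambda>_. 1) p = real n"
proof (induction n arbitrary: x)
  case 0
  then have "x = y" using inj_pos by (auto dest: injD)
  then have "awalk x [] y" by (simp add: awalk_Nil_iff pverts_eq)
  then show ?case by (intro exI[of _ "[]"]) simp
next
  case (Suc n)
  define k where "k = (if pos x < pos y then pos x + 1 else pos x - 1)"
  have "min (pos x) (pos y) \<le> k" and k: "\<bar>pos x - k\<bar> = 1" "\<bar>k - pos y\<bar> = int n"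
    using Suc.prems by (auto simp: k_def)
  then have "k \<in> range pos"
    using range_upward[of "min (pos x) (pos y)" k] by (auto simp: min_def split: if_splits)
  then obtain z where z: "k = pos z" by auto
  obtain p where "awalk z p y" "awalk_cost (\<lambda>_. 1) p = real n"
    using Suc.IH[of z] k z by auto
  then have "awalk x ((x, z) # p) y \<and> awalk_cost (\<lambda>_. 1) ((x, z) # p) = real (Suc n)"
    using k z by (simp add: awalk_Cons_iff parcs_eq)
  then show ?case by blast
qed

lemma graph_dist_eq: "graph_dist G x y = real_of_int \<bar>pos x - pos y\<bar>"
proof -
  obtain p where p: "awalk x p y" "awalk_cost (\<lambda>_. 1) p = real_of_int \<bar>pos x - pos y\<bar>"
    using ex_awalk_of_dist[of x y "nat \<bar>pos x - pos y\<bar>"] by auto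
  have "\<mu> (\<lambda>_. 1) x y = ereal (real_of_int \<bar>pos x - pos y\<bar>)"
  proof (rule antisym)
    show "\<mu> (\<lambda>_. 1) x y \<le> ereal (real_of_int \<bar>pos x - pos y\<bar>)"
      using min_cost_le_walk_cost[OF p(1), of "\<lambda>_. 1"] p(2) by simp
    show "ereal (real_of_int \<bar>pos x - pos y\<bar>) \<le> \<mu> (\<lambda>_. 1) x y"
      unfolding \<mu>_def by (rule INF_greatest) (use dist_le_awalk_cost in simp)
  qed
  then show ?thesis by (simp add: graph_dist_def)
qed

section \<open>The quadratic form and partial sums\<close>

lemma inner_on_finite_support:
  assumes "finite S" and "\<And>x. x \<notin> S \<Longrightarrow> f x * g x = 0"
  shows "inner_on (pverts G) f g = (\<Sum>x\<in>S. f x * g x)"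
proof -
  have "inner_on (pverts G) f g = (\<Sum>\<^sub>\<infinity>x\<in>S. f x * g x)"
    unfolding inner_on_def pverts_eq by (rule infsum_cong_neutral) (use assms in auto)
  then show ?thesis using assms(1) by simp
qed

lemma quadratic_form_finite_support:
  assumes "finite S" and "\<And>x. x \<notin> S \<Longrightarrow> f x = 0"
  shows "inner_on (pverts G) f (dist_matrix_app G f)
    = (\<Sum>x\<in>S. \<Sum>y\<in>S. f x * f y * real_of_int \<bar>pos x - pos y\<bar>)"
proof -
  have "dist_matrix_app G f x = (\<Sum>y\<in>S. real_of_int \<bar>pos x - pos y\<bar> * f y)" for x
  proof -
    have "dist_matrix_app G f x = (\<Sum>\<^sub>\<infinity>y\<in>S. real_of_int \<bar>pos x - pos y\<bar> * f y)"
      unfolding dist_matrix_app_def pverts_eq graph_dist_eq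
      by (rule infsum_cong_neutral) (use assms in auto)
    then show ?thesis using assms(1) by simp
  qed
  then show ?thesis
    using assms inner_on_finite_support[of S f "dist_matrix_app G f"]
    by (simp add: sum_distrib_left mult_ac)
qed

end

text \<open>
  A cut at \<open>k\<close> separates \<open>i\<close> from \<open>j\<close> exactly when the two indicators differ. Indicators being
  idempotent, the squared difference expands to the summand below.
\<close>

lemma int_dist_eq_sum_cuts:
  fixes a b i j :: int
  assumes "a \<le> i" "i \<le> b" "a \<le> j" "j \<le> b"
  shows "real_of_int \<bar>i - j\<bar>
    = (\<Sum>k\<in>{a..<b}. of_bool (i \<le> k) + of_bool (j \<le> k) - 2 * (of_bool (i \<le> k) * of_bool (j \<le> k)))"
proof -
  have "(\<Sum>k\<in>{a..<b}. of_bool (i \<le> k) + of_bool (j \<le> k) - 2 * (of_bool (i \<le> k) * of_bool (j \<le> k)))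
      = (\<Sum>k\<in>{a..<b}. if k \<in> {min i j..<max i j} then 1 else (0::real))"
    by (rule sum.cong) auto
  also have "\<dots> = (\<Sum>k\<in>{a..<b} \<inter> {min i j..<max i j}. 1)"
    by (rule sum.inter_restrict[symmetric]) simp
  also have "{a..<b} \<inter> {min i j..<max i j} = {min i j..<max i j}"
    using assms by auto
  also have "(\<Sum>k\<in>{min i j..<max i j}. 1) = real_of_int \<bar>i - j\<bar>"
    by (auto simp: min_def max_def)
  finally show ?thesis by simp
qed

text \<open>
  In \<open>int_dist_eq_sum_cuts\<close> the terms that involve only one of the two points contribute a multiple
  of the total sum, which is 0; the product of the two indicators contributes the square
  of a partial sum.
\<close>

lemma sum_dist_eq_partial_sums:
  fixes f :: "'a \<Rightarrow> real" and h :: "'a \<Rightarrow> int"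
  assumes total: "sum f S = 0" and bounds: "\<And>x. x \<in> S \<Longrightarrow> a \<le> h x \<and> h x \<le> b"
  shows "(\<Sum>x\<in>S. \<Sum>y\<in>S. f x * f y * real_of_int \<bar>h x - h y\<bar>)
    = - 2 * (\<Sum>k\<in>{a..<b}. (\<Sum>x\<in>S. f x * of_bool (h x \<le> k))\<^sup>2)"
proof -
  define F where "F k = (\<Sum>x\<in>S. f x * of_bool (h x \<le> k))" for k
  let ?c = "\<lambda>k x. of_bool (h x \<le> k) :: real"
  have "(\<Sum>x\<in>S. \<Sum>y\<in>S. f x * f y * real_of_int \<bar>h x - h y\<bar>)
      = (\<Sum>x\<in>S. \<Sum>y\<in>S. \<Sum>k\<in>{a..<b}. f x * f y * (?c k x + ?c k y - 2 * (?c k x * ?c k y)))"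
  proof (intro sum.cong refl)
    fix x y assume "x \<in> S" "y \<in> S"
    then have "real_of_int \<bar>h x - h y\<bar> = (\<Sum>k\<in>{a..<b}. ?c k x + ?c k y - 2 * (?c k x * ?c k y))"
      using bounds by (intro int_dist_eq_sum_cuts) auto
    then show "f x * f y * real_of_int \<bar>h x - h y\<bar>
        = (\<Sum>k\<in>{a..<b}. f x * f y * (?c k x + ?c k y - 2 * (?c k x * ?c k y)))"
      by (simp only: sum_distrib_left)
  qed
  also have "\<dots> = (\<Sum>x\<in>S. \<Sum>k\<in>{a..<b}. \<Sum>y\<in>S. f x * f y * (?c k x + ?c k y - 2 * (?c k x * ?c k y)))"
    by (intro sum.cong refl sum.swap)
  also have "\<dots> = (\<Sum>k\<in>{a..<b}. \<Sum>x\<in>S. \<Sum>y\<in>S. f x * f y * (?c k x + ?c k y - 2 * (?c k x * ?c k y)))"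
    by (rule sum.swap)
  also have "\<dots> = (\<Sum>k\<in>{a..<b}. - 2 * (F k)\<^sup>2)"
  proof (rule sum.cong[OF refl])
    fix k
    have "(\<Sum>x\<in>S. \<Sum>y\<in>S. f x * f y * (?c k x + ?c k y - 2 * (?c k x * ?c k y)))
        = (\<Sum>x\<in>S. \<Sum>y\<in>S. (f x * ?c k x) * f y + f x * (f y * ?c k y)
            - 2 * ((f x * ?c k x) * (f y * ?c k y)))"
      by (intro sum.cong refl) (simp only: algebra_simps)
    also have "\<dots> = F k * sum f S + sum f S * F k - 2 * (F k * F k)"
      unfolding F_def sum_product by (simp only: sum.distrib sum_subtractf sum_distrib_left)
    also have "\<dots> = - 2 * (F k)\<^sup>2"
      using total by (simp add: power2_eq_square)
    finally show "(\<Sum>x\<in>S. \<Sum>y\<in>S. f x * f y * (?c k x + ?c k y - 2 * (?c k x * ?c k y)))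
        = - 2 * (F k)\<^sup>2" .
  qed
  finally show ?thesis by (simp add: F_def sum_distrib_left)
qed

section \<open>The upper bound\<close>

text \<open>
  By injectivity, \<open>f x\<close> is a difference of two consecutive partial sums, and each partial sum
  occurs in at most two such differences, so \<open>(u - v)\<^sup>2 \<le> 2 * u\<^sup>2 + 2 * v\<^sup>2\<close> gives the constant 4.
  The strict bounds keep both \<open>h x\<close> and \<open>h x - 1\<close> within the range of summation.
\<close>

lemma sum_squares_le_partial_sums:
  fixes f :: "'a \<Rightarrow> real" and h :: "'a \<Rightarrow> int"
  assumes fin: "finite S" and inj: "inj_on h S"
    and bounds: "\<And>x. x \<in> S \<Longrightarrow> a < h x \<and> h x < b"
  shows "(\<Sum>x\<in>S. (f x)\<^sup>2) \<le> 4 * (\<Sum>k\<in>{a..<b}. (\<Sum>x\<in>S. f x * of_bool (h x \<le> k))\<^sup>2)"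
proof -
  define F where "F k = (\<Sum>x\<in>S. f x * of_bool (h x \<le> k))" for k
  have f_eq: "f x = F (h x) - F (h x - 1)" if "x \<in> S" for x
  proof -
    have "F (h x) - F (h x - 1)
        = (\<Sum>y\<in>S. f y * of_bool (h y \<le> h x) - f y * of_bool (h y \<le> h x - 1))"
      by (simp add: F_def sum_subtractf)
    also have "\<dots> = (\<Sum>y\<in>S. if y = x then f y else 0)"
      by (rule sum.cong) (use inj that in \<open>auto simp: inj_on_def\<close>)
    finally show ?thesis using fin that by simp
  qed
  have bound: "(\<Sum>x\<in>S. (F (h x - d))\<^sup>2) \<le> (\<Sum>k\<in>{a..<b}. (F k)\<^sup>2)" if "d \<in> {0, 1}" for d
  proof -
    have "inj_on (\<lambda>x. h x - d) S" using inj by (auto simp: inj_on_def)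
    then have "(\<Sum>x\<in>S. (F (h x - d))\<^sup>2) = (\<Sum>k\<in>(\<lambda>x. h x - d) ` S. (F k)\<^sup>2)"
      by (simp add: sum.reindex)
    also have "\<dots> \<le> (\<Sum>k\<in>{a..<b}. (F k)\<^sup>2)"
      using bounds that by (intro sum_mono2) force+
    finally show ?thesis .
  qed
  have "(\<Sum>x\<in>S. (f x)\<^sup>2) \<le> (\<Sum>x\<in>S. 2 * (F (h x - 0))\<^sup>2 + 2 * (F (h x - 1))\<^sup>2)"
  proof (rule sum_mono)
    fix x assume "x \<in> S"
    have "0 \<le> (F (h x) + F (h x - 1))\<^sup>2" by simp
    then show "(f x)\<^sup>2 \<le> 2 * (F (h x - 0))\<^sup>2 + 2 * (F (h x - 1))\<^sup>2"
      unfolding f_eq[OF \<open>x \<in> S\<close>] by (simp add: power2_eq_square algebra_simps)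
  qed
  also have "\<dots> = 2 * (\<Sum>x\<in>S. (F (h x - 0))\<^sup>2) + 2 * (\<Sum>x\<in>S. (F (h x - 1))\<^sup>2)"
    by (simp add: sum.distrib sum_distrib_left)
  also have "\<dots> \<le> 4 * (\<Sum>k\<in>{a..<b}. (F k)\<^sup>2)"
    using bound[of 0] bound[of 1] by simp
  finally show ?thesis by (simp add: F_def)
qed

context integer_path
begin

lemma QEC_le: "QEC G \<le> ereal (- 1 / 2)"
  unfolding QEC_def
proof (rule Sup_least, clarify)
  fix f :: "'a \<Rightarrow> real"
  assume "f \<in> C0 (pverts G)" and norm: "inner_on (pverts G) f f = 1"
    and total: "inner_on (pverts G) (\<lambda>_. 1) f = 0"
  define S where "S = {x. f x \<noteq> 0}"
  have S: "finite S" "\<And>x. x \<notin> S \<Longrightarrow> f x = 0"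
    using \<open>f \<in> C0 (pverts G)\<close> by (auto simp: S_def C0_def)
  define a b where "a = Min (insert 0 (pos ` S)) - 1" and "b = Max (insert 0 (pos ` S)) + 1"
  have ab: "a < pos x \<and> pos x < b" if "x \<in> S" for x
  proof -
    have "Min (insert 0 (pos ` S)) \<le> pos x" "pos x \<le> Max (insert 0 (pos ` S))"
      using S(1) that by (auto intro!: Min_le Max_ge)
    then show ?thesis by (simp add: a_def b_def)
  qed
  have "sum f S = 0"
    using total inner_on_finite_support[of S "\<lambda>_. 1" f] S by simp
  then have "inner_on (pverts G) f (dist_matrix_app G f)
      = - 2 * (\<Sum>k\<in>{a..<b}. (\<Sum>x\<in>S. f x * of_bool (pos x \<le> k))\<^sup>2)"
    using quadratic_form_finite_support[OF S] sum_dist_eq_partial_sums[of f S a pos b] ab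
    by (simp add: less_imp_le)
  moreover have "(\<Sum>x\<in>S. (f x)\<^sup>2) = 1"
    using norm inner_on_finite_support[of S f f] S by (simp add: power2_eq_square)
  then have "1 \<le> 4 * (\<Sum>k\<in>{a..<b}. (\<Sum>x\<in>S. f x * of_bool (pos x \<le> k))\<^sup>2)"
    using sum_squares_le_partial_sums[of S pos a b f] S(1) ab inj_on_subset[OF inj_pos]
    by simp
  ultimately show "ereal (inner_on (pverts G) f (dist_matrix_app G f)) \<le> ereal (- 1 / 2)"
    by simp
qed

end

section \<open>Alternating functions attain the bound in the limit\<close>

text \<open>The increments of the sequence \<open>1, -1, 1, \<dots>\<close> of length \<open>n\<close>, extended by zeros.\<close>

definition alternating_increments :: "nat \<Rightarrow> nat \<Rightarrow> real" where
  "alternating_increments n i =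
    (if i = 0 then 1 else if i < n then 2 * (-1) ^ i else if i = n then (-1) ^ n else 0)"

lemma sum_alternating_increments:
  "k < n \<Longrightarrow> (\<Sum>i\<le>k. alternating_increments n i) = (-1) ^ k"
  by (induction k) (simp_all add: alternating_increments_def)

lemma sum_alternating_increments_total:
  "(\<Sum>i\<le>Suc m. alternating_increments (Suc m) i) = 0"
  using sum_alternating_increments[of m "Suc m"] by (simp add: alternating_increments_def)

lemma sum_alternating_increments_squares:
  "(\<Sum>i\<le>Suc m. (alternating_increments (Suc m) i)\<^sup>2) = 4 * real m + 2"
proof -
  have "(\<Sum>i\<le>k. (alternating_increments (Suc m) i)\<^sup>2) = 4 * real k + 1" if "k \<le> m" for k
    using that
    by (induction k) (simp_all add: alternating_increments_def power_mult_distrib flip: power_mult)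
  from this[of m] show ?thesis
    by (simp add: alternating_increments_def flip: power_mult)
qed

context integer_path
begin

text \<open>
  For \<open>n = m + 1\<close> the alternating function has \<open>\<langle>f, f\<rangle> = 4 * m + 2\<close>, so it is scaled by \<open>c\<close>, the
  inverse square root of this. All \<open>n\<close> nonzero partial sums then have square \<open>c\<^sup>2\<close>, which gives
  \<open>- 2 * n * c\<^sup>2\<close> for the quadratic form.
\<close>

lemma QEC_ge_alternating: "ereal (- real (Suc m) / (2 * real m + 1)) \<le> QEC G"
proof -
  define n where "n = Suc m"
  define c where "c = 1 / sqrt (4 * real m + 2)"
  have c2: "c\<^sup>2 = 1 / (4 * real m + 2)"
    by (simp add: c_def power_divide)
  define f where "f x = (if 0 \<le> pos x then c * alternating_increments n (nat (pos x)) else 0)" for x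
  \<comment> \<open>The vertices at positions \<open>0, \<dots>, n\<close> carry the support of \<open>f\<close>, so that sums over the
    support become sums over natural numbers.\<close>
  define v where "v i = inv pos (int i)" for i
  have pos_v: "pos (v i) = int i" for i
    unfolding v_def using range_upward[OF zero_in_range, of "int i"] by (simp add: f_inv_into_f)
  have inj_v: "inj_on v A" for A
    by (metis inj_onI of_nat_eq_iff pos_v)
  define S where "S = v ` {..n}"
  have sum_S: "(\<Sum>x\<in>S. g x) = (\<Sum>i\<le>n. g (v i))" for g :: "'a \<Rightarrow> real"
    by (simp add: S_def sum.reindex[OF inj_v])
  have f_v: "f (v i) = c * alternating_increments n i" for i
    by (simp add: f_def pos_v)
  have "finite S" by (simp add: S_def)
  have outside: "f x = 0" if "x \<notin> S" for x
  proof (cases "0 \<le> pos x")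
    case True
    then have "x = v (nat (pos x))" by (intro injD[OF inj_pos]) (simp add: pos_v)
    then have "\<not> nat (pos x) \<le> n" using that by (auto simp: S_def)
    then show ?thesis by (simp add: f_def alternating_increments_def)
  qed (simp add: f_def)
  have total: "sum f S = 0"
    using sum_alternating_increments_total[of m]
    by (simp add: sum_S f_v n_def del: sum.atMost_Suc flip: sum_distrib_left)
  have "{x. f x \<noteq> 0} \<subseteq> S" using outside by blast
  then have "f \<in> C0 (pverts G)"
    using \<open>finite S\<close> by (auto simp: C0_def pverts_eq intro: finite_subset)
  moreover have "inner_on (pverts G) f f = 1"
  proof -
    have "inner_on (pverts G) f f = (\<Sum>i\<le>n. c\<^sup>2 * (alternating_increments n i)\<^sup>2)"
      using inner_on_finite_support[of S f f] \<open>finite S\<close> outside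
      by (simp add: sum_S f_v power2_eq_square mult_ac)
    also have "\<dots> = c\<^sup>2 * (4 * real m + 2)"
      unfolding n_def sum_distrib_left[symmetric] sum_alternating_increments_squares ..
    also have "\<dots> = 1" by (simp add: c2)
    finally show ?thesis .
  qed
  moreover have "inner_on (pverts G) (\<lambda>_. 1) f = 0"
    using inner_on_finite_support[of S "\<lambda>_. 1" f] \<open>finite S\<close> outside total by simp
  ultimately have "ereal (inner_on (pverts G) f (dist_matrix_app G f)) \<le> QEC G"
    unfolding QEC_def by (intro Sup_upper) blast
  also have "inner_on (pverts G) f (dist_matrix_app G f)
      = - 2 * (\<Sum>k\<in>{0..<int n}. (\<Sum>x\<in>S. f x * of_bool (pos x \<le> k))\<^sup>2)"
    using quadratic_form_finite_support[OF \<open>finite S\<close> outside]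
      sum_dist_eq_partial_sums[OF total, of 0 pos "int n"]
    by (force simp: S_def pos_v)
  also have "(\<Sum>k\<in>{0..<int n}. (\<Sum>x\<in>S. f x * of_bool (pos x \<le> k))\<^sup>2) = (\<Sum>k\<in>{0..<int n}. c\<^sup>2)"
  proof (rule sum.cong[OF refl])
    fix k assume k: "k \<in> {0..<int n}"
    have "(\<Sum>x\<in>S. f x * of_bool (pos x \<le> k))
        = (\<Sum>i\<le>n. c * (if i \<in> {..nat k} then alternating_increments n i else 0))"
      unfolding sum_S f_v pos_v using k by (intro sum.cong) auto
    also have "\<dots> = c * (\<Sum>i\<in>{..n} \<inter> {..nat k}. alternating_increments n i)"
      by (simp only: sum.inter_restrict finite_atMost sum_distrib_left[symmetric])
    also have "{..n} \<inter> {..nat k} = {..nat k}" using k by auto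
    also have "(\<Sum>i\<le>nat k. alternating_increments n i) = (-1) ^ nat k"
      using k by (intro sum_alternating_increments) auto
    finally show "(\<Sum>x\<in>S. f x * of_bool (pos x \<le> k))\<^sup>2 = c\<^sup>2"
      by (simp add: power_mult_distrib flip: power_mult)
  qed
  also have "- 2 * (\<Sum>k\<in>{0..<int n}. c\<^sup>2) = - real (Suc m) / (2 * real m + 1)"
    by (simp add: c2 n_def field_simps)
  finally show ?thesis .
qed

lemma QEC_eq: "QEC G = ereal (- 1 / 2)"
proof (rule antisym[OF QEC_le])
  have "(\<lambda>m. - real (Suc m) / (2 * real m + 1)) \<longlonglongrightarrow> - 1 / 2"
    by real_asymp
  then have "(\<lambda>m. ereal (- real (Suc m) / (2 * real m + 1))) \<longlonglongrightarrow> ereal (- 1 / 2)"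
    by simp
  then show "ereal (- 1 / 2) \<le> QEC G"
    by (rule LIMSEQ_le_const2) (use QEC_ge_alternating in blast)
qed

end

theorem theorem5p7:
  shows "QEC line_graph_Z_plus = QEC line_graph_Z \<and> QEC line_graph_Z = ereal (- 1 / 2)"
proof -
  interpret Z: integer_path line_graph_Z "\<lambda>k. k"
    by unfold_locales (auto simp: line_graph_Z_def)
  interpret Z_plus: integer_path line_graph_Z_plus int
  proof
    show "l \<in> range int" if "k \<in> range int" "k \<le> l" for k l
      using that by (metis dual_order.trans imageE of_nat_0_le_iff rangeI zero_le_imp_eq_int)
  qed (auto simp: line_graph_Z_plus_def)
  show ?thesis using Z.QEC_eq Z_plus.QEC_eq by simp
qed

end
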